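(* For all integers $m\ge1$, $r\ge1$ and $k\ge2$, \begin{align*} &\sum_{\substack{a_1,\ldots,a_k\ge0\\ a_1+\cdots+a_k=m}}\binom{a_k+r}{r}\,T(a_1+1,\ldots,a_{k-1}+1,a_k+r+1)\\ &\quad+(-1)^k\sum_{\substack{a_1,\ldots,a_k\ge0\\ a_1+\cdots+a_k=r}}\binom{a_k+m}{m}\,T(a_1+1,\ldots,a_{k-1}+1,a_k+m+1)\\ &=\sum_{j=0}^{k-2}(-1)^j\,T(\underbrace{1,\ldots,1}_{r-1},k-j)\,T(\underbrace{1,\ldots,1}_{j},m+1). \end{align*}
   Context: For positive integers $k_1,\ldots,k_r$ with $k_r\ge2$, \[T(k_1,\ldots,k_r)=2^{r}\sum_{\substack{0<m_1<\cdots<m_r\\ m_i\equiv i\bmod 2}}\frac{1}{m_1^{k_1}\cdots m_r^{k_r}},\] where the summation variables $m_1,m_2,m_3,\ldots$ are alternately odd, even, odd, \ldots; in particular $T(n)=2\sum_{\ell\ge0}(2\ell+1)^{-n}$ for $n\ge2$. *)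

theory Defs
  imports "HOL-Analysis.Analysis"
begin

text \<open>Lists are indexed from 0, so the paper's $m_{i+1}$ is \<open>ms ! i\<close> and the condition
  $m_i \equiv i$ modulo 2 becomes \<open>ms ! i mod 2 = Suc i mod 2\<close>.\<close>

definition T_indices :: "nat \<Rightarrow> nat list set" where
  "T_indices r = {ms. length ms = r \<and> sorted_wrt (<) ms \<and>
     (\<forall>i<r. 0 < ms ! i \<and> ms ! i mod 2 = Suc i mod 2)}"

text \<open>All terms are nonnegative, so unordered summation is the usual convergence of the series.
  The definition is meant for lists of positive integers whose last entry is at least 2;
  on other lists the value carries no meaning.\<close>

definition T :: "nat list \<Rightarrow> real" where
  "T ks = 2 ^ length ks *
     (\<Sum>\<^sub>\<infinity>ms\<in>T_indices (length ks). \<Prod>i<length ks. 1 / real (ms ! i) ^ (ks ! i))"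

definition weak_compositions :: "nat \<Rightarrow> nat \<Rightarrow> nat list set" where
  "weak_compositions k n = {as. length as = k \<and> sum_list as = n}"

end

theory Submission
  imports Defs "HOL-Probability.Distributions"
begin

text \<open>Let \<open>\<mu>\<close> be the measure $du / \sinh u$ on the positive reals and $N(u) = -\log\tanh(u/2)$, so
  that $dN = -d\mu$ and $N$ is an involution. Substituting $t = e^{-u}$ in the iterated integral of a
  \<open>T\<close>-value and summing over compositions, the first sum of the theorem becomes the integral of
  \[\frac{(N(s) - N(q))^{k-2}}{(k-2)!}\,\frac{q^m}{m!}\,\frac{s^r}{r!}\]
  over the half $s \le q$ of the square with respect to \<open>\<mu> \<times> \<mu>\<close>. The second sum is the integral of the
  same function over the other half. Over the whole square the binomial theorem separates the
  variables, and each factor is the value $T(1,\ldots,1,n)$ or its dual, obtained by the substitution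
  $u \mapsto N(u)$. All integrals are first computed in the extended nonnegative reals, where Tonelli's
  theorem needs no convergence argument.\<close>

subsection \<open>Divided powers and the involution\<close>

text \<open>Dividing by the factorial makes the binomial theorem free of coefficients
  (\<open>dpow_add\<close>) and makes differentiation lower the index by exactly one
  (\<open>DERIV_dpow_Suc\<close>).\<close>

definition dpow :: "real \<Rightarrow> nat \<Rightarrow> real" where
  "dpow x n = x ^ n / fact n"

lemma dpow_0 [simp]: "dpow x 0 = 1"
  by (simp add: dpow_def)

lemma dpow_nonneg: "0 \<le> x \<Longrightarrow> 0 \<le> dpow x n"
  by (simp add: dpow_def)

lemma dpow_zero_Suc [simp]: "dpow 0 (Suc n) = 0"
  by (simp add: dpow_def)

lemma dpow_measurable [measurable]:
  "f \<in> borel_measurable M \<Longrightarrow> (\<lambda>x. dpow (f x) n) \<in> borel_measurable M"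
  unfolding dpow_def by (intro borel_measurable_divide borel_measurable_power borel_measurable_const)

lemma DERIV_dpow_Suc:
  "((\<lambda>x. dpow x (Suc n)) has_real_derivative dpow x n) (at x)"
proof -
  have "((\<lambda>x. x ^ Suc n / fact (Suc n)) has_real_derivative
          real (Suc n) * x ^ n / fact (Suc n)) (at x)"
    by (rule DERIV_cdivide) (metis DERIV_pow One_nat_def diff_Suc_1)
  moreover have "real (Suc n) * x ^ n / fact (Suc n) = dpow x n"
    unfolding dpow_def fact_Suc of_nat_mult
    by (rule mult_divide_mult_cancel_left) simp
  ultimately show ?thesis by (simp add: dpow_def)
qed

lemma dpow_add: "dpow (x + y) n = (\<Sum>i\<le>n. dpow x i * dpow y (n - i))"
proof -
  have "dpow (x + y) n = (\<Sum>i\<le>n. real (n choose i) * x ^ i * y ^ (n - i)) / fact n"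
    by (simp add: dpow_def binomial_ring)
  also have "\<dots> = (\<Sum>i\<le>n. dpow x i * dpow y (n - i))"
    unfolding sum_divide_distrib
    by (intro sum.cong refl) (simp add: dpow_def binomial_fact field_simps)
  finally show ?thesis .
qed

lemma dpow_minus: "dpow (- x) n = (-1) ^ n * dpow x n"
  by (simp add: dpow_def power_minus[of x])

lemma dpow_mult: "dpow x i * dpow x n = real ((i + n) choose n) * dpow x (i + n)"
  by (simp add: dpow_def binomial_fact power_add)

text \<open>This is N from the overview: for positive u it equals log coth(u/2) = 2
  artanh(e^(-u)).\<close>

definition lcoth :: "real \<Rightarrow> real" where
  "lcoth u = - ln (tanh (u / 2))"

lemma lcoth_measurable [measurable]: "lcoth \<in> borel_measurable borel"
proof -
  have "(tanh :: real \<Rightarrow> real) \<in> borel_measurable borel"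
    by (intro borel_measurable_continuous_onI continuous_intros) auto
  then show ?thesis unfolding lcoth_def by measurable
qed

lemma lcoth_pos: "0 < u \<Longrightarrow> 0 < lcoth u"
  unfolding lcoth_def using tanh_real_lt_1[of "u / 2"] by simp

lemma DERIV_lcoth:
  assumes "0 < u"
  shows "(lcoth has_real_derivative - (1 / sinh u)) (at u)"
proof -
  have s: "sinh u = 2 * sinh (u / 2) * cosh (u / 2)"
    using sinh_double[of "u / 2"] by simp
  have pos: "sinh (u / 2) > 0" "cosh (u / 2) > 0" using assms by auto
  have "1 - tanh (u / 2) ^ 2 = (cosh (u / 2) ^ 2 - sinh (u / 2) ^ 2) / cosh (u / 2) ^ 2"
    using pos by (simp add: tanh_def power_divide diff_divide_distrib)
  also have "\<dots> = 1 / cosh (u / 2) ^ 2"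
    by (simp add: cosh_square_eq)
  finally have sech: "1 - tanh (u / 2) ^ 2 = 1 / cosh (u / 2) ^ 2" .
  have eq: "(1 - tanh (u / 2) ^ 2) * (1 / 2) / tanh (u / 2) = 1 / sinh u"
    using pos unfolding s sech by (simp add: tanh_def field_simps power2_eq_square)
  have "(lcoth has_real_derivative - ((1 - tanh (u / 2) ^ 2) * (1 / 2) / tanh (u / 2))) (at u)"
    unfolding lcoth_def [abs_def] using assms pos
    by (auto intro!: derivative_eq_intros)
  then show ?thesis unfolding eq .
qed

lemma lcoth_antimono:
  assumes "0 < u" "u \<le> v"
  shows "lcoth v \<le> lcoth u"
  using assms by (simp add: lcoth_def)

text \<open>In the coordinate t = e^(-u) the map is t -> (1 - t)/(1 + t), which is its own
  inverse.\<close>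

lemma lcoth_lcoth:
  assumes "0 < u"
  shows "lcoth (lcoth u) = u"
proof -
  let ?t = "tanh (u / 2)"
  have t: "0 < ?t" using assms by simp
  \<comment> \<open>The exponent is left unsimplified to match the formula for tanh in
    \<open>tanh_real_altdef\<close>.\<close>
  have "exp (- 2 * (lcoth u / 2)) = ?t"
    using t by (simp add: lcoth_def)
  then have "tanh (lcoth u / 2) = (1 - ?t) / (1 + ?t)"
    unfolding tanh_real_altdef by simp
  also have "\<dots> = exp (- u)"
  proof -
    have "1 + exp (- u) \<noteq> 0" by (simp add: add_pos_pos less_imp_neq[symmetric])
    then show ?thesis unfolding tanh_real_altdef by (simp add: field_simps)
  qed
  finally show ?thesis by (simp add: lcoth_def)
qed

lemma tendsto_lcoth_at_top: "(lcoth \<longlongrightarrow> 0) at_top"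
proof -
  have "filterlim (\<lambda>u::real. u / 2) at_top at_top"
    by (rule filterlim_tendsto_pos_mult_at_top[of "\<lambda>_. 1/2", simplified]) (auto simp: filterlim_ident)
  then have "((\<lambda>u::real. tanh (u / 2)) \<longlongrightarrow> 1) at_top"
    by (rule filterlim_compose[OF tanh_real_at_top])
  then have "((\<lambda>u::real. - ln (tanh (u / 2))) \<longlongrightarrow> - ln 1) at_top"
    by (intro tendsto_intros) auto
  then show ?thesis by (simp add: lcoth_def [abs_def])
qed

subsection \<open>The measure $du/\sinh u$\<close>

text \<open>The density vanishes for \<open>u \<le> 0\<close>: \<open>ennreal\<close> sends negative numbers to 0, and \<open>1 / sinh 0 = 0\<close>.\<close>

definition csch_measure :: "real measure" where
  "csch_measure = density lborel (\<lambda>u. ennreal (1 / sinh u))"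

lemma sinh_measurable [measurable]: "(sinh :: real \<Rightarrow> real) \<in> borel_measurable borel"
  by (intro borel_measurable_continuous_onI continuous_intros)

lemma sets_csch_measure [simp, measurable_cong]: "sets csch_measure = sets borel"
  by (simp add: csch_measure_def)

lemma space_csch_measure [simp]: "space csch_measure = UNIV"
  by (simp add: csch_measure_def)

lemma nn_integral_csch_measure:
  assumes [measurable]: "f \<in> borel_measurable borel"
  shows "(\<integral>\<^sup>+u. f u \<partial>csch_measure) = (\<integral>\<^sup>+u. ennreal (1 / sinh u) * f u \<partial>lborel)"
  unfolding csch_measure_def by (rule nn_integral_density) auto

lemma AE_csch_measure_pos: "AE u in csch_measure. 0 < u"
  unfolding csch_measure_def
  by (subst AE_density) (auto simp: not_less intro!: AE_I2)

lemma AE_csch_measure_neq: "AE u in csch_measure. u \<noteq> c"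
  unfolding csch_measure_def
  by (subst AE_density) (use AE_lborel_singleton[of c] in \<open>auto elim!: eventually_mono\<close>)

lemma sigma_finite_csch_measure: "sigma_finite_measure csch_measure"
  unfolding csch_measure_def
  by (subst sigma_finite_measure.sigma_finite_iff_density_finite) (auto intro: lborel.sigma_finite_measure_axioms)

interpretation csch: sigma_finite_measure csch_measure
  by (rule sigma_finite_csch_measure)

interpretation csch2: pair_sigma_finite csch_measure csch_measure ..

interpretation csch_lborel: pair_sigma_finite csch_measure lborel ..

text \<open>Since dN = -d\<mu>, the function \<open>- dpow (lcoth s) (Suc p)\<close> is an
  antiderivative, and it tends to 0 at infinity.\<close>

lemma nn_integral_csch_dpow_lcoth_tail:
  assumes "0 < u"
  shows "(\<integral>\<^sup>+s. ennreal (dpow (lcoth s) p) * indicator {u..} s \<partial>csch_measure)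
    = ennreal (dpow (lcoth u) (Suc p))"
proof -
  have "(\<integral>\<^sup>+s. ennreal (dpow (lcoth s) p) * indicator {u..} s \<partial>csch_measure)
      = (\<integral>\<^sup>+s. ennreal (1 / sinh s * dpow (lcoth s) p) * indicator {u..} s \<partial>lborel)"
    by (subst nn_integral_csch_measure)
       (use assms in \<open>auto intro!: nn_integral_cong split: split_indicator simp: ennreal_mult'[symmetric]\<close>)
  also have "\<dots> = 0 - (- dpow (lcoth u) (Suc p))"
  proof (rule nn_integral_FTC_atLeast)
    fix x assume "u \<le> x"
    then have x: "0 < x" using assms by simp
    show "((\<lambda>x. - dpow (lcoth x) (Suc p)) has_real_derivative 1 / sinh x * dpow (lcoth x) p) (at x)"
      using DERIV_minus[OF DERIV_chain2[OF DERIV_dpow_Suc DERIV_lcoth[OF x]]]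
      by (simp add: mult.commute)
    show "0 \<le> 1 / sinh x * dpow (lcoth x) p"
      using x by (intro mult_nonneg_nonneg dpow_nonneg) (auto intro: less_imp_le lcoth_pos)
  next
    have "((\<lambda>x. - dpow (lcoth x) (Suc p)) \<longlongrightarrow> - (0 ^ Suc p / fact (Suc p))) at_top"
      unfolding dpow_def by (intro tendsto_intros tendsto_lcoth_at_top) auto
    then show "((\<lambda>x. - dpow (lcoth x) (Suc p)) \<longlongrightarrow> 0) at_top" by simp
  qed measurable
  finally show ?thesis by simp
qed

text \<open>The same antiderivative, shifted to vanish at \<open>q\<close>. Iterating it gives the
  \<mu>-volume of a simplex of ordered points between \<open>u\<close> and \<open>q\<close>.\<close>

lemma nn_integral_csch_dpow_lcoth_Icc:
  assumes "0 < u" "u \<le> q"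
  shows "(\<integral>\<^sup>+s. ennreal (dpow (lcoth s - lcoth q) p) * indicator {u..q} s \<partial>csch_measure)
    = ennreal (dpow (lcoth u - lcoth q) (Suc p))"
proof -
  have "(\<integral>\<^sup>+s. ennreal (dpow (lcoth s - lcoth q) p) * indicator {u..q} s \<partial>csch_measure)
      = (\<integral>\<^sup>+s. ennreal (1 / sinh s * dpow (lcoth s - lcoth q) p) * indicator {u..q} s \<partial>lborel)"
    by (subst nn_integral_csch_measure)
       (use assms in \<open>auto intro!: nn_integral_cong split: split_indicator simp: ennreal_mult'[symmetric]\<close>)
  also have "\<dots> = ennreal (- dpow (lcoth q - lcoth q) (Suc p) - (- dpow (lcoth u - lcoth q) (Suc p)))"
  proof (rule nn_integral_FTC_Icc)
    fix x assume x': "x \<in> {u..q}"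
    then have x: "0 < x" using assms by simp
    have "((\<lambda>x. lcoth x - lcoth q) has_real_derivative - (1 / sinh x)) (at x)"
      using DERIV_diff[OF DERIV_lcoth[OF x] DERIV_const[of "lcoth q"]] by simp
    from DERIV_minus[OF DERIV_chain2[OF DERIV_dpow_Suc this]]
    have "((\<lambda>x. - dpow (lcoth x - lcoth q) (Suc p)) has_real_derivative
        1 / sinh x * dpow (lcoth x - lcoth q) p) (at x)"
      by (simp add: mult.commute)
    then show "((\<lambda>x. - dpow (lcoth x - lcoth q) (Suc p)) has_real_derivative
        1 / sinh x * dpow (lcoth x - lcoth q) p) (at x)" .
    show "0 \<le> 1 / sinh x * dpow (lcoth x - lcoth q) p"
      using x x' by (intro mult_nonneg_nonneg dpow_nonneg) (auto intro: lcoth_antimono)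
  qed (use assms in auto)
  finally show ?thesis by simp
qed

lemma nn_integral_dpow_Icc:
  assumes "0 \<le> s"
  shows "(\<integral>\<^sup>+x. ennreal (dpow x n) * indicator {0..s} x \<partial>lborel) = ennreal (dpow s (Suc n))"
proof -
  have "(\<integral>\<^sup>+x. ennreal (dpow x n) * indicator {0..s} x \<partial>lborel)
      = ennreal (dpow s (Suc n) - dpow 0 (Suc n))"
    by (rule nn_integral_FTC_Icc)
      (use assms in \<open>auto intro: dpow_nonneg simp: DERIV_dpow_Suc\<close>)
  then show ?thesis by simp
qed

text \<open>N carries \<mu> to Lebesgue measure on the positive reals. The change of variables is
  done on compact intervals that exhaust the half-line, followed by monotone convergence on both
  sides.\<close>

lemma nn_integral_lcoth_substitution:
  fixes f :: "real \<Rightarrow> real"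
  assumes [measurable]: "f \<in> borel_measurable borel"
  shows "(\<integral>\<^sup>+v. ennreal (f (lcoth v)) \<partial>csch_measure) = (\<integral>\<^sup>+x. ennreal (f x) * indicator {0<..} x \<partial>lborel)"
proof -
  \<comment> \<open>The offset 2 keeps the left endpoint positive and strictly below the right one,
    for every n. As N is a decreasing involution, \<open>B n\<close> is the image of
    \<open>A n\<close>, with the endpoints exchanged.\<close>
  define A where "A n = {1 / (real n + 2)..real n + 2}" for n
  define B where "B n = {lcoth ((real n + 2))..lcoth (1 / (real n + 2))}" for n
  have ltA: "1 / (real n + 2) < real n + 2" for n
    by (rule less_trans[of _ 1]) auto
  have mono1: "1 / (real n + 2) \<le> 1 / (real m + 2)" if "m \<le> n" for m n
    using that by (simp add: frac_le)
  have memA: "v \<in> A n" if "0 < v" "nat \<lceil>max v (1 / v)\<rceil> \<le> n" for v n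
  proof -
    have "max v (1 / v) \<le> (real n + 2)" using that(2) by linarith
    then show ?thesis using that(1) by (auto simp: A_def field_simps)
  qed
  have evA: "\<forall>\<^sub>F n in sequentially. v \<in> A n" if "0 < v" for v
    unfolding eventually_sequentially using memA[OF that] by blast
  have B: "x \<in> B n \<longleftrightarrow> lcoth x \<in> A n" if "0 < x" for x n
  proof -
    have "lcoth y \<le> x \<longleftrightarrow> lcoth x \<le> y" "x \<le> lcoth y \<longleftrightarrow> y \<le> lcoth x" if "0 < y" for y
      using that \<open>0 < x\<close> lcoth_antimono[of x "lcoth y"] lcoth_antimono[of "lcoth x" y]
        lcoth_antimono[of "lcoth y" x] lcoth_antimono[of y "lcoth x"] lcoth_lcoth[of x] lcoth_lcoth[of y]
        lcoth_pos[of x] lcoth_pos[of y] by auto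
    from this(1)[of "(real n + 2)"] this(2)[of "1 / (real n + 2)"] show ?thesis
      by (auto simp: A_def B_def)
  qed
  have Bpos: "x \<in> B n \<Longrightarrow> 0 < x" for x n
    using lcoth_pos[of "(real n + 2)"] by (auto simp: B_def)
  have Apos: "x \<in> A n \<Longrightarrow> 0 < x" for x n
    by (auto simp: A_def intro: less_le_trans[of 0 "1 / (real n + 2)"])
  have incA: "A m \<subseteq> A n" if "m \<le> n" for m n
    using mono1[OF that] that unfolding A_def by (auto intro: order_trans)
  have incB: "B m \<subseteq> B n" if "m \<le> n" for m n
    using incA[OF that] B Bpos by blast
  have [measurable]: "A n \<in> sets borel" "B n \<in> sets borel" for n
    by (auto simp: A_def B_def)
  have eq: "(\<integral>\<^sup>+v. ennreal (f (lcoth v)) * indicator (A n) v \<partial>csch_measure)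
      = (\<integral>\<^sup>+x. ennreal (f x) * indicator (B n) x \<partial>lborel)" for n
  proof -
    \<comment> \<open>The substitution rule asks for a nonnegative derivative, but N decreases;
      composing with negation repairs this, and a reflection undoes it afterwards.\<close>
    let ?a = "- (real n + 2)" and ?b = "- (1 / (real n + 2))"
    have "(\<integral>\<^sup>+x. ennreal (f x) * indicator (B n) x \<partial>lborel)
       = (\<integral>\<^sup>+x. ennreal (f x) * indicator {(\<lambda>x. lcoth (- x)) ?a..(\<lambda>x. lcoth (- x)) ?b} x \<partial>lborel)"
      by (simp add: B_def add.commute)
    also have "\<dots> = (\<integral>\<^sup>+x. ennreal (f (lcoth (- x))) * ennreal (1 / sinh (- x)) * indicator {?a..?b} x \<partial>lborel)"
    proof (rule nn_integral_substitution_aux)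
      fix x assume "x \<in> {?a..?b}"
      then have x: "0 < - x"
        by (auto intro: le_less_trans[of x "- (1 / (real n + 2))" 0])
      have "((\<lambda>x::real. - x) has_real_derivative - 1) (at x)"
        by (auto intro!: derivative_eq_intros)
      from DERIV_chain2[OF DERIV_lcoth[OF x] this]
      show "((\<lambda>x. lcoth (- x)) has_real_derivative 1 / sinh (- x)) (at x)" by simp
      show "0 \<le> 1 / sinh (- x)" using x by simp
    next
      show "continuous_on {?a..?b} (\<lambda>x. 1 / sinh (- x))"
        by (intro continuous_intros) (auto simp: divide_le_0_iff dest: order_trans[of _ "- (1 / (real n + 2))" 0])
    next
      show "?a < ?b" using ltA[of n] by linarith
    qed auto
    also have "\<dots> = (\<integral>\<^sup>+x. ennreal (f (lcoth x)) * ennreal (1 / sinh x) * indicator {?a..?b} (- x) \<partial>lborel)"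
      by (subst nn_integral_real_affine[where c="-1" and t=0]) (auto simp: A_def)
    also have "\<dots> = (\<integral>\<^sup>+v. ennreal (f (lcoth v)) * indicator (A n) v \<partial>csch_measure)"
      by (subst nn_integral_csch_measure) (auto simp: A_def mult_ac intro!: nn_integral_cong split: split_indicator)
    finally show ?thesis by simp
  qed
  have lim1: "(\<lambda>n. \<integral>\<^sup>+v. ennreal (f (lcoth v)) * indicator (A n) v \<partial>csch_measure)
      \<longlonglongrightarrow> (\<integral>\<^sup>+v. ennreal (f (lcoth v)) * indicator {0<..} v \<partial>csch_measure)"
  proof (rule nn_integral_LIMSEQ)
    show "incseq (\<lambda>n v. ennreal (f (lcoth v)) * indicator (A n) v)"
      using incA by (auto simp: incseq_def le_fun_def split: split_indicator)
    show "(\<lambda>n. ennreal (f (lcoth v)) * indicator (A n) v) \<longlonglongrightarrow> ennreal (f (lcoth v)) * indicator {0<..} v" for v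
    proof (rule tendsto_eventually, cases "0 < v")
      case True
      then show "\<forall>\<^sub>F n in sequentially. ennreal (f (lcoth v)) * indicator (A n) v = ennreal (f (lcoth v)) * indicator {0<..} v"
        by (intro eventually_mono[OF evA[OF True]]) simp
    next
      case False
      then have "v \<notin> A n" for n using Apos by blast
      with False show "\<forall>\<^sub>F n in sequentially. ennreal (f (lcoth v)) * indicator (A n) v = ennreal (f (lcoth v)) * indicator {0<..} v"
        by simp
    qed
  qed measurable
  have lim2: "(\<lambda>n. \<integral>\<^sup>+v. ennreal (f v) * indicator (B n) v \<partial>lborel)
      \<longlonglongrightarrow> (\<integral>\<^sup>+v. ennreal (f v) * indicator {0<..} v \<partial>lborel)"
  proof (rule nn_integral_LIMSEQ)
    show "incseq (\<lambda>n v. ennreal (f v) * indicator (B n) v)"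
      using incB by (auto simp: incseq_def le_fun_def split: split_indicator)
    show "(\<lambda>n. ennreal (f v) * indicator (B n) v) \<longlonglongrightarrow> ennreal (f v) * indicator {0<..} v" for v
    proof (rule tendsto_eventually, cases "0 < v")
      case True
      then show "\<forall>\<^sub>F n in sequentially. ennreal (f v) * indicator (B n) v = ennreal (f v) * indicator {0<..} v"
        by (intro eventually_mono[OF evA[OF lcoth_pos[OF True]]]) (simp add: B)
    next
      case False
      then have "v \<notin> B n" for n using Bpos by blast
      with False show "\<forall>\<^sub>F n in sequentially. ennreal (f v) * indicator (B n) v = ennreal (f v) * indicator {0<..} v"
        by simp
    qed
  qed measurable
  have "(\<integral>\<^sup>+v. ennreal (f (lcoth v)) \<partial>csch_measure) = (\<integral>\<^sup>+v. ennreal (f (lcoth v)) * indicator {0<..} v \<partial>csch_measure)"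
    by (intro nn_integral_cong_AE eventually_mono[OF AE_csch_measure_pos]) auto
  then show ?thesis
    using LIMSEQ_unique[OF lim1] lim2 unfolding eq by simp
qed

subsection \<open>T-values as iterated integrals\<close>

text \<open>With $z = e^{-u}$ this is a term of the series
  $2^r \sum z^{m_r} / (m_1^{k_1} \cdots m_r^{k_r})$, with $m_0 = 0$ for the empty list.\<close>

definition T_term :: "nat list \<Rightarrow> real \<Rightarrow> nat list \<Rightarrow> real" where
  "T_term ks u ms = 2 ^ length ks * (\<Prod>i<length ks. 1 / real (ms ! i) ^ (ks ! i)) *
     exp (- real (last (0 # ms)) * u)"

definition T_series :: "nat list \<Rightarrow> real \<Rightarrow> ennreal" where
  "T_series ks u = (\<integral>\<^sup>+ms. ennreal (T_term ks u ms) \<partial>count_space (T_indices (length ks)))"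

lemma T_term_nonneg: "0 \<le> T_term ks u ms"
  unfolding T_term_def by (intro mult_nonneg_nonneg prod_nonneg) auto

text \<open>In the divergent case both sides are 0.\<close>

lemma infsum_eq_enn2real:
  fixes f :: "'a \<Rightarrow> real"
  assumes "\<And>x. 0 \<le> f x"
  shows "infsum f A = enn2real (\<integral>\<^sup>+x. ennreal (f x) \<partial>count_space A)"
proof (cases "integrable (count_space A) f")
  case True
  then have "infsetsum f A = infsum f A"
    by (intro infsetsum_infsum) (simp add: abs_summable_on_def)
  then show ?thesis
    using assms nn_integral_eq_integral[OF True] by (simp add: infsetsum_def infsum_nonneg)
next
  case False
  then have "\<not> f summable_on A"
    using abs_summable_equivalent[of f A] summable_on_iff_abs_summable_on_real[of f A]
    by (simp add: abs_summable_on_def)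
  moreover have "(\<integral>\<^sup>+x. ennreal (f x) \<partial>count_space A) = \<infinity>"
    using False assms by (auto simp: integrable_iff_bounded less_top[symmetric])
  ultimately show ?thesis by (simp add: infsum_not_exists)
qed

lemma T_eq_enn2real_T_series: "T ks = enn2real (T_series ks 0)"
proof -
  have "T ks = (\<Sum>\<^sub>\<infinity>ms\<in>T_indices (length ks). T_term ks 0 ms)"
    unfolding T_def T_term_def by (subst infsum_cmult_right'[symmetric]) simp
  then show ?thesis
    unfolding T_series_def by (simp add: infsum_eq_enn2real T_term_nonneg)
qed

lemma T_series_measurable [measurable]: "T_series ks \<in> borel_measurable borel"
proof -
  interpret sigma_finite_measure "count_space (T_indices (length ks))"
    by (intro sigma_finite_measure_count_space_countable) auto
  have "(\<lambda>(ms, u). ennreal (T_term ks u ms)) \<in> borel_measurable (count_space (T_indices (length ks)) \<Otimes>\<^sub>M borel)"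
    by (rule measurable_pair_measure_countable1) (auto simp: T_term_def)
  from borel_measurable_nn_integral[OF measurable_pair_swap[OF this, simplified]] show ?thesis
    by (simp add: T_series_def [abs_def])
qed

section \<open>Enumeration of the index lists by appending entries\<close>

lemma T_indices_0 [simp]: "T_indices 0 = {[]}"
  by (auto simp: T_indices_def)

lemma T_series_Nil [simp]: "T_series [] u = 1"
  by (simp add: T_series_def T_term_def nn_integral_count_space_finite)

text \<open>In an increasing list only the last entry constrains a new one. The sentinel 0 covers
  the empty list, where the bound becomes positivity of \<open>n\<close>.\<close>

lemma T_indices_snoc_iff:
  "ms @ [n] \<in> T_indices (Suc r) \<longleftrightarrow>
     ms \<in> T_indices r \<and> last (0 # ms) < n \<and> n mod 2 = Suc r mod 2"
proof -
  have "(\<forall>x\<in>set ms. x < n) \<and> 0 < n \<longleftrightarrow> last (0 # ms) < n" if "sorted_wrt (<) ms"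
  proof (cases ms rule: rev_cases)
    case (snoc ns x)
    then show ?thesis using that by (auto simp: sorted_wrt_append)
  qed auto
  moreover have "ms @ [n] \<in> T_indices (Suc r) \<longleftrightarrow>
      ms \<in> T_indices r \<and> ((\<forall>x\<in>set ms. x < n) \<and> 0 < n) \<and> n mod 2 = Suc r mod 2"
    unfolding T_indices_def by (auto simp: sorted_wrt_append nth_append less_Suc_eq)
  moreover have "sorted_wrt (<) ms" if "ms \<in> T_indices r"
    using that by (simp add: T_indices_def)
  ultimately show ?thesis by blast
qed

text \<open>For a nonempty list this is the parity condition at the last position; for the empty
  list the sentinel 0 is even, as required.\<close>

lemma last_mod_2:
  assumes "ms \<in> T_indices r"
  shows "last (0 # ms) mod 2 = r mod 2"
  using assms by (cases ms rule: rev_cases) (auto simp: T_indices_def)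

text \<open>Consecutive entries have opposite parity, also counting the sentinel, so the gaps are
  exactly the odd numbers 2j + 1.\<close>

lemma bij_betw_T_indices_Suc:
  "bij_betw (\<lambda>(ms, j). ms @ [last (0 # ms) + 2 * j + 1]) (T_indices r \<times> UNIV) (T_indices (Suc r))"
  unfolding bij_betw_def
proof (intro conjI equalityI subsetI)
  show "inj_on (\<lambda>(ms, j). ms @ [last (0 # ms) + 2 * j + 1]) (T_indices r \<times> UNIV)"
    by (auto simp: inj_on_def)
next
  fix ns assume "ns \<in> (\<lambda>(ms, j). ms @ [last (0 # ms) + 2 * j + 1]) ` (T_indices r \<times> UNIV)"
  then obtain ms j where ms: "ms \<in> T_indices r" and ns: "ns = ms @ [last (0 # ms) + 2 * j + 1]"
    by auto
  have "(last (0 # ms) + 2 * j + 1) mod 2 = Suc r mod 2"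
    using last_mod_2[OF ms] by presburger
  then show "ns \<in> T_indices (Suc r)"
    unfolding ns T_indices_snoc_iff using ms by simp
next
  fix ns assume ns: "ns \<in> T_indices (Suc r)"
  then have "ns \<noteq> []" by (auto simp: T_indices_def)
  then obtain ms n where eq: "ns = ms @ [n]" by (cases ns rule: rev_cases) auto
  with ns have ms: "ms \<in> T_indices r" "last (0 # ms) < n" "n mod 2 = Suc r mod 2"
    by (simp_all add: T_indices_snoc_iff)
  obtain d where d: "n = Suc (last (0 # ms) + d)"
    using less_imp_Suc_add[OF ms(2)] by blast
  have "even d"
    using ms(3) last_mod_2[OF ms(1)] unfolding d by presburger
  then obtain j where "d = 2 * j" by blast
  then have "ns = (\<lambda>(ms, j). ms @ [last (0 # ms) + 2 * j + 1]) (ms, j)"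
    unfolding eq d by simp
  then show "ns \<in> (\<lambda>(ms, j). ms @ [last (0 # ms) + 2 * j + 1]) ` (T_indices r \<times> UNIV)"
    using ms(1) by (intro image_eqI) auto
qed

lemma nn_integral_T_indices_Suc:
  "(\<integral>\<^sup>+ns. f ns \<partial>count_space (T_indices (Suc r)))
    = (\<integral>\<^sup>+ms. (\<integral>\<^sup>+j. f (ms @ [last (0 # ms) + 2 * j + 1]) \<partial>count_space UNIV) \<partial>count_space (T_indices r))"
proof -
  let ?g = "\<lambda>(ms, j). f (ms @ [last (0 # ms) + 2 * j + 1]) * indicator (T_indices r \<times> UNIV) (ms, j :: nat)"
  have "(\<integral>\<^sup>+ns. f ns \<partial>count_space (T_indices (Suc r)))
      = (\<integral>\<^sup>+x. ?g x \<partial>count_space UNIV)"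
    by (subst nn_integral_bij_count_space[OF bij_betw_T_indices_Suc, symmetric])
       (auto simp: nn_integral_count_space_indicator split_beta' intro!: nn_integral_cong)
  also have "\<dots> = (\<integral>\<^sup>+ms. (\<integral>\<^sup>+j. ?g (ms, j) \<partial>count_space UNIV) \<partial>count_space UNIV)"
    by (rule nn_integral_fst_count_space[symmetric])
  also have "\<dots> = (\<integral>\<^sup>+ms. (\<integral>\<^sup>+j. f (ms @ [last (0 # ms) + 2 * j + 1]) \<partial>count_space UNIV)
       * indicator (T_indices r) ms \<partial>count_space UNIV)"
    by (intro nn_integral_cong) (auto split: split_indicator)
  finally show ?thesis by (simp add: nn_integral_count_space_indicator)
qed

section \<open>The integral recursion for the series\<close>

lemma T_term_snoc:
  assumes "length ms = length ks"
  shows "T_term (ks @ [k]) u (ms @ [n]) = 2 * (T_term ks 0 ms / real n ^ k * exp (- real n * u))"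
  using assms by (simp add: T_term_def nth_append)

text \<open>After the shift s = u + x the integrand is a constant times the Erlang density of rate
  \<open>l\<close>, whose total mass is 1.\<close>

lemma nn_integral_dpow_exp_tail:
  assumes "0 < l"
  shows "(\<integral>\<^sup>+s. ennreal (dpow (s - u) i * exp (- l * s)) * indicator {u..} s \<partial>lborel)
    = ennreal (exp (- l * u) / l ^ Suc i)"
proof -
  have "(\<integral>\<^sup>+s. ennreal (dpow (s - u) i * exp (- l * s)) * indicator {u..} s \<partial>lborel)
      = (\<integral>\<^sup>+x. ennreal (dpow x i * exp (- l * (u + x))) * indicator {u..} (u + x) \<partial>lborel)"
    by (subst nn_integral_real_affine[where c=1 and t=u]) auto
  also have "\<dots> = (\<integral>\<^sup>+x. ennreal (exp (- l * u) / l ^ Suc i) * ennreal (erlang_density i l x) \<partial>lborel)"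
    using assms
    by (intro nn_integral_cong)
       (auto simp: erlang_density_def dpow_def ennreal_mult'[symmetric] algebra_simps exp_add exp_diff exp_minus
          field_simps split: split_indicator)
  also have "\<dots> = ennreal (exp (- l * u) / l ^ Suc i) * (\<integral>\<^sup>+x. ennreal (erlang_density i l x) \<partial>lborel)"
    by (rule nn_integral_cmult) simp
  also have "(\<integral>\<^sup>+x. ennreal (erlang_density i l x) \<partial>lborel) = 1"
    using prob_space.emeasure_space_1[OF prob_space_erlang_density[OF assms, of i]]
    by (simp add: emeasure_density)
  finally show ?thesis by simp
qed

text \<open>Geometric series for 2 e^(-s) / (1 - e^(-2s)). Its exponents are the odd gaps between
  consecutive summation variables.\<close>

lemma csch_eq_nn_integral:
  assumes "0 < s"
  shows "ennreal (1 / sinh s) = (\<integral>\<^sup>+j. ennreal (2 * exp (- real (2 * j + 1) * s)) \<partial>count_space UNIV)"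
proof -
  have "(\<lambda>j. 2 * exp (- s) * exp (- 2 * s) ^ j) sums (2 * exp (- s) * (1 / (1 - exp (- 2 * s))))"
    using assms by (intro sums_mult geometric_sums) auto
  moreover have "(\<lambda>j. 2 * exp (- s) * exp (- 2 * s) ^ j) = (\<lambda>j. 2 * exp (- real (2 * j + 1) * s))"
    by (simp add: exp_of_nat_mult[symmetric] mult_exp_exp algebra_simps)
  moreover have "2 * exp (- s) * (1 / (1 - exp (- 2 * s))) = 1 / sinh s"
  proof -
    have "exp (- 2 * s) = exp (- s) * exp (- s)" by (simp add: mult_exp_exp)
    moreover have "exp s > exp (- s)" using assms by simp
    moreover have "exp s * exp (- s) = 1" by (simp add: mult_exp_exp)
    moreover have "exp (- s) * exp (- s) < 1" using assms by (simp add: mult_exp_exp)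
    ultimately show ?thesis by (simp add: sinh_field_def field_simps)
  qed
  ultimately have "(\<lambda>j. 2 * exp (- real (2 * j + 1) * s)) sums (1 / sinh s)" by (simp only:)
  then have "(\<Sum>j. ennreal (2 * exp (- real (2 * j + 1) * s))) = ennreal (1 / sinh s)"
    by (intro suminf_ennreal_eq) simp
  then show ?thesis unfolding nn_integral_count_space_nat ..
qed

text \<open>Expanding the density 1/sinh s and multiplying by e^(-m s), with m the last index,
  produces 2 e^(-n s) for every admissible next index n = m + 2j + 1. Integrating this against
  \<open>dpow (s - u) i\<close> over s \<ge> u gives the factor 1/n^(i+1) and leaves e^(-n u).
  Repeated use yields nested variables in which the last argument has the smallest variable.\<close>

lemma T_series_snoc:
  assumes "0 \<le> u"
  shows "T_series (ks @ [Suc i]) u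
    = (\<integral>\<^sup>+s. ennreal (dpow (s - u) i) * T_series ks s * indicator {u..} s \<partial>csch_measure)"
proof -
  let ?I = "T_indices (length ks)"
  let ?n = "\<lambda>ms j. last (0 # ms) + 2 * j + 1"
  let ?f = "\<lambda>ms j s. ennreal (2 * (T_term ks 0 ms * (dpow (s - u) i * exp (- real (?n ms j) * s)))) * indicator {u..} s"
  have "(\<integral>\<^sup>+s. ennreal (dpow (s - u) i) * T_series ks s * indicator {u..} s \<partial>csch_measure)
      = (\<integral>\<^sup>+s. ennreal (1 / sinh s) * (ennreal (dpow (s - u) i) * T_series ks s * indicator {u..} s) \<partial>lborel)"
    by (rule nn_integral_csch_measure) measurable
  also have "\<dots> = (\<integral>\<^sup>+s. (\<integral>\<^sup>+ms. (\<integral>\<^sup>+j. ?f ms j s \<partial>count_space UNIV) \<partial>count_space ?I) \<partial>lborel)"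
  \<comment> \<open>For u = 0 the range includes s = 0, where the geometric series diverges; this
    point is a null set.\<close>
  proof (intro nn_integral_cong_AE eventually_mono[OF AE_lborel_singleton[of 0]])
    fix s :: real assume "s \<noteq> 0"
    show "ennreal (1 / sinh s) * (ennreal (dpow (s - u) i) * T_series ks s * indicator {u..} s)
        = (\<integral>\<^sup>+ms. (\<integral>\<^sup>+j. ?f ms j s \<partial>count_space UNIV) \<partial>count_space ?I)"
    proof (cases "u \<le> s")
      case True
      then have s: "0 < s" using assms \<open>s \<noteq> 0\<close> by simp
      have "ennreal (1 / sinh s) * (ennreal (dpow (s - u) i) * T_series ks s)
          = (\<integral>\<^sup>+ms. (\<integral>\<^sup>+j. ennreal (dpow (s - u) i) * ennreal (T_term ks s ms) *
               ennreal (2 * exp (- real (2 * j + 1) * s)) \<partial>count_space UNIV) \<partial>count_space ?I)"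
        unfolding T_series_def csch_eq_nn_integral[OF s]
        by (simp add: nn_integral_cmult nn_integral_multc mult_ac)
      also have "\<dots> = (\<integral>\<^sup>+ms. (\<integral>\<^sup>+j. ?f ms j s \<partial>count_space UNIV) \<partial>count_space ?I)"
        using True
        by (intro nn_integral_cong)
           (simp add: T_term_def ennreal_mult'[symmetric] ennreal_mult''[symmetric] prod_nonneg dpow_nonneg mult_exp_exp algebra_simps)
      finally show ?thesis using True by simp
    qed simp
  qed
  also have "\<dots> = (\<integral>\<^sup>+ms. (\<integral>\<^sup>+j. (\<integral>\<^sup>+s. ?f ms j s \<partial>lborel) \<partial>count_space UNIV) \<partial>count_space ?I)"
  proof -
    have [measurable]: "?f ms j \<in> borel_measurable lborel" for ms j
      by measurable
    have "(\<lambda>s. \<integral>\<^sup>+j. ?f ms j s \<partial>count_space UNIV) \<in> borel_measurable lborel" for ms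
      unfolding nn_integral_count_space_nat by measurable
    then have "(\<integral>\<^sup>+s. (\<integral>\<^sup>+ms. (\<integral>\<^sup>+j. ?f ms j s \<partial>count_space UNIV) \<partial>count_space ?I) \<partial>lborel)
        = (\<integral>\<^sup>+ms. (\<integral>\<^sup>+s. (\<integral>\<^sup>+j. ?f ms j s \<partial>count_space UNIV) \<partial>lborel) \<partial>count_space ?I)"
      by (rule nn_integral_count_space_nn_integral[OF countableI_type])
    also have "(\<lambda>ms. (\<integral>\<^sup>+s. (\<integral>\<^sup>+j. ?f ms j s \<partial>count_space UNIV) \<partial>lborel))
        = (\<lambda>ms. (\<integral>\<^sup>+j. (\<integral>\<^sup>+s. ?f ms j s \<partial>lborel) \<partial>count_space UNIV))"
      by (intro ext nn_integral_count_space_nn_integral countableI_type) measurable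
    finally show ?thesis .
  qed
  also have "\<dots> = (\<integral>\<^sup>+ms. (\<integral>\<^sup>+j. ennreal (T_term (ks @ [Suc i]) u (ms @ [?n ms j])) \<partial>count_space UNIV) \<partial>count_space ?I)"
  proof (intro nn_integral_cong)
    fix ms j assume "ms \<in> space (count_space ?I)"
    then have len: "length ms = length ks" by (simp add: T_indices_def)
    have n_pos: "0 < real (?n ms j)" by simp
    have "(\<integral>\<^sup>+s. ?f ms j s \<partial>lborel)
        = (\<integral>\<^sup>+s. ennreal (2 * T_term ks 0 ms) * (ennreal (dpow (s - u) i * exp (- real (?n ms j) * s)) * indicator {u..} s) \<partial>lborel)"
      using T_term_nonneg
      by (intro nn_integral_cong) (simp add: mult.assoc[symmetric] ennreal_mult'[symmetric])
    also have "\<dots> = ennreal (2 * T_term ks 0 ms) * ennreal (exp (- real (?n ms j) * u) / real (?n ms j) ^ Suc i)"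
      unfolding nn_integral_dpow_exp_tail[symmetric, of "real (?n ms j)", OF n_pos]
      by (rule nn_integral_cmult) measurable
    also have "\<dots> = ennreal (T_term (ks @ [Suc i]) u (ms @ [?n ms j]))"
      unfolding T_term_snoc[OF len] using T_term_nonneg[of ks 0 ms]
      by (simp add: ennreal_mult'[symmetric] del: power_Suc)
    finally show "(\<integral>\<^sup>+s. ?f ms j s \<partial>lborel) = ennreal (T_term (ks @ [Suc i]) u (ms @ [?n ms j]))" .
  qed
  also have "\<dots> = T_series (ks @ [Suc i]) u"
    unfolding T_series_def by (simp add: nn_integral_T_indices_Suc)
  finally show ?thesis ..
qed

subsection \<open>Sums over compositions\<close>

lemma finite_weak_compositions [simp]: "finite (weak_compositions k n)"
proof (rule finite_subset)
  show "weak_compositions k n \<subseteq> {as. set as \<subseteq> {..n} \<and> length as = k}"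
    by (auto simp: weak_compositions_def intro: member_le_sum_list)
qed (simp add: finite_lists_length_eq)

lemma sum_weak_compositions_Suc:
  fixes f :: "nat list \<Rightarrow> 'a :: comm_monoid_add"
  shows "sum f (weak_compositions (Suc k) n) = (\<Sum>i\<le>n. \<Sum>as\<in>weak_compositions k (n - i). f (as @ [i]))"
proof -
  let ?h = "\<lambda>(i, as). as @ [i]"
  have "bij_betw ?h (SIGMA i:{..n}. weak_compositions k (n - i)) (weak_compositions (Suc k) n)"
    unfolding bij_betw_def
  proof (intro conjI equalityI subsetI)
    fix bs assume bs: "bs \<in> weak_compositions (Suc k) n"
    then obtain as i where "bs = as @ [i]"
      by (cases bs rule: rev_cases) (auto simp: weak_compositions_def)
    with bs show "bs \<in> ?h ` (SIGMA i:{..n}. weak_compositions k (n - i))"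
      by (intro image_eqI[where x="(i, as)"]) (auto simp: weak_compositions_def)
  qed (auto simp: inj_on_def weak_compositions_def)
  from sum.reindex_bij_betw[OF this, of f] show ?thesis
    by (simp add: sum.Sigma split_beta)
qed

lemma weak_compositions_1: "weak_compositions (Suc 0) n = {[n]}"
  by (auto simp: weak_compositions_def length_Suc_conv)

text \<open>Here \<open>q\<close> is the largest variable, belonging to the first argument, and the
  power of the \<open>lcoth\<close> difference is the \<mu>-volume of \<open>p\<close> ordered
  variables between \<open>s\<close> and \<open>q\<close>. The base point \<open>u\<close> is kept
  separate from \<open>s\<close> so that an offset s - u can be absorbed.\<close>

definition tail_integral :: "nat \<Rightarrow> nat \<Rightarrow> real \<Rightarrow> real \<Rightarrow> ennreal" where
  "tail_integral p n u s = (\<integral>\<^sup>+q. ennreal (dpow (lcoth s - lcoth q) p * dpow (q - u) n) * indicator {s..} q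
     \<partial>csch_measure)"

lemma indicator_tail_measurable [measurable]:
  "(\<lambda>(s, q). indicator {s..} q :: ennreal) \<in> borel_measurable (borel \<Otimes>\<^sub>M (borel :: real measure))"
proof -
  have "(\<lambda>(s, q). indicator {s..} q :: ennreal) = (\<lambda>x::real \<times> real. indicator {x. fst x \<le> snd x} x)"
    by (auto simp: fun_eq_iff split: split_indicator)
  then show ?thesis by simp
qed

lemma tail_integral_measurable [measurable]: "tail_integral p n u \<in> borel_measurable borel"
  unfolding tail_integral_def [abs_def] by measurable

text \<open>The binomial theorem for q - u = (s - u) + (q - s), applied under the integral; all
  divided powers are nonnegative on the domain.\<close>

lemma sum_dpow_tail_integral:
  assumes "0 < s" "u \<le> s"
  shows "(\<Sum>i\<le>n. ennreal (dpow (s - u) i) * tail_integral p (n - i) s s) = tail_integral p n u s"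
proof -
  have "(\<Sum>i\<le>n. ennreal (dpow (s - u) i) * tail_integral p (n - i) s s)
      = (\<Sum>i\<le>n. \<integral>\<^sup>+q. ennreal (dpow (s - u) i) * (ennreal (dpow (lcoth s - lcoth q) p * dpow (q - s) (n - i)) * indicator {s..} q) \<partial>csch_measure)"
    unfolding tail_integral_def by (intro sum.cong refl nn_integral_cmult[symmetric]) measurable
  also have "\<dots> = (\<integral>\<^sup>+q. (\<Sum>i\<le>n. ennreal (dpow (s - u) i) * (ennreal (dpow (lcoth s - lcoth q) p * dpow (q - s) (n - i)) * indicator {s..} q)) \<partial>csch_measure)"
    by (intro nn_integral_sum[symmetric]) measurable
  also have "\<dots> = tail_integral p n u s"
    unfolding tail_integral_def
  proof (intro nn_integral_cong)
    fix q
    show "(\<Sum>i\<le>n. ennreal (dpow (s - u) i) * (ennreal (dpow (lcoth s - lcoth q) p * dpow (q - s) (n - i)) * indicator {s..} q))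
        = ennreal (dpow (lcoth s - lcoth q) p * dpow (q - u) n) * indicator {s..} q"
    proof (cases "s \<le> q")
      case True
      have nn: "0 \<le> dpow (lcoth s - lcoth q) p" "0 \<le> dpow (s - u) i" "0 \<le> dpow (q - s) i" for i
        using assms True lcoth_antimono[of s q] by (auto intro: dpow_nonneg)
      have "(\<Sum>i\<le>n. ennreal (dpow (s - u) i) * ennreal (dpow (lcoth s - lcoth q) p * dpow (q - s) (n - i)))
          = ennreal (\<Sum>i\<le>n. dpow (s - u) i * (dpow (lcoth s - lcoth q) p * dpow (q - s) (n - i)))"
        using nn by (simp add: ennreal_mult'[symmetric] sum_ennreal)
      also have "(\<Sum>i\<le>n. dpow (s - u) i * (dpow (lcoth s - lcoth q) p * dpow (q - s) (n - i)))
          = dpow (lcoth s - lcoth q) p * dpow (q - u) n"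
        using dpow_add[of "s - u" "q - s" n] by (simp add: sum_distrib_left mult_ac)
      finally show ?thesis using True by simp
    qed simp
  qed
  finally show ?thesis .
qed

text \<open>Summing over all compositions merges the divided powers of the successive differences
  into one of the telescoped difference q - u. The \<open>p\<close> intermediate variables then
  occur only through their order and integrate to a simplex volume. The induction splits off the
  last part, that is, the smallest variable.\<close>

lemma sum_T_series_weak_compositions:
  assumes "0 < u"
  shows "(\<Sum>as\<in>weak_compositions (Suc p) n. T_series (map Suc as) u) = tail_integral p n u u"
  using assms
proof (induction p arbitrary: n u)
  case 0
  then show ?case
    using T_series_snoc[of u "[]" n] by (simp add: weak_compositions_1 tail_integral_def)
next
  case (Suc p)
  have "(\<Sum>as\<in>weak_compositions (Suc (Suc p)) n. T_series (map Suc as) u)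
      = (\<Sum>i\<le>n. \<Sum>as\<in>weak_compositions (Suc p) (n - i).
          \<integral>\<^sup>+s. ennreal (dpow (s - u) i) * T_series (map Suc as) s * indicator {u..} s \<partial>csch_measure)"
    using Suc.prems by (subst sum_weak_compositions_Suc) (simp add: T_series_snoc)
  also have "\<dots> = (\<integral>\<^sup>+s. (\<Sum>i\<le>n. \<Sum>as\<in>weak_compositions (Suc p) (n - i).
          ennreal (dpow (s - u) i) * T_series (map Suc as) s * indicator {u..} s) \<partial>csch_measure)"
    by (simp add: nn_integral_sum del: sum_mult_indicator)
  also have "\<dots> = (\<integral>\<^sup>+s. tail_integral p n u s * indicator {u..} s \<partial>csch_measure)"
  proof (intro nn_integral_cong)
    fix s
    show "(\<Sum>i\<le>n. \<Sum>as\<in>weak_compositions (Suc p) (n - i).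
          ennreal (dpow (s - u) i) * T_series (map Suc as) s * indicator {u..} s)
       = tail_integral p n u s * indicator {u..} s"
    proof (cases "u \<le> s")
      case True
      with Suc.prems have s: "0 < s" by simp
      show ?thesis
        using True by (simp add: sum_distrib_left[symmetric] Suc.IH[OF s] sum_dpow_tail_integral[OF s])
    qed simp
  qed
  also have "\<dots> = (\<integral>\<^sup>+s. (\<integral>\<^sup>+q. ennreal (dpow (lcoth s - lcoth q) p * dpow (q - u) n) * indicator {s..} q
       * indicator {u..} s \<partial>csch_measure) \<partial>csch_measure)"
    unfolding tail_integral_def by (intro nn_integral_cong nn_integral_multc[symmetric]) measurable
  also have "\<dots> = (\<integral>\<^sup>+q. (\<integral>\<^sup>+s. ennreal (dpow (lcoth s - lcoth q) p * dpow (q - u) n) * indicator {s..} q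
       * indicator {u..} s \<partial>csch_measure) \<partial>csch_measure)"
    by (rule csch2.Fubini') measurable
  \<comment> \<open>After the exchange \<open>s\<close> runs between \<open>u\<close> and
    \<open>q\<close>, and integrating it out raises the exponent of the \<open>lcoth\<close>
    difference by one.\<close>
  also have "\<dots> = tail_integral (Suc p) n u u"
    unfolding tail_integral_def
  proof (intro nn_integral_cong)
    fix q
    show "(\<integral>\<^sup>+s. ennreal (dpow (lcoth s - lcoth q) p * dpow (q - u) n) * indicator {s..} q * indicator {u..} s \<partial>csch_measure)
      = ennreal (dpow (lcoth u - lcoth q) (Suc p) * dpow (q - u) n) * indicator {u..} q"
    proof (cases "u \<le> q")
      case True
      then have nn: "0 \<le> dpow (q - u) n" by (simp add: dpow_nonneg)
      have "(\<integral>\<^sup>+s. ennreal (dpow (lcoth s - lcoth q) p * dpow (q - u) n) * indicator {s..} q * indicator {u..} s \<partial>csch_measure)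
        = (\<integral>\<^sup>+s. (ennreal (dpow (lcoth s - lcoth q) p) * indicator {u..q} s) * ennreal (dpow (q - u) n) \<partial>csch_measure)"
        using nn by (intro nn_integral_cong) (auto simp: ennreal_mult'' split: split_indicator)
      also have "\<dots> = ennreal (dpow (lcoth u - lcoth q) (Suc p)) * ennreal (dpow (q - u) n)"
        unfolding nn_integral_csch_dpow_lcoth_Icc[OF Suc.prems True, symmetric]
        by (rule nn_integral_multc) measurable
      finally show ?thesis using True nn by (simp add: ennreal_mult'')
    next
      case False
      then have zero: "ennreal (dpow (lcoth s - lcoth q) p * dpow (q - u) n) * indicator {s..} q * indicator {u..} s = 0" for s
        by (auto split: split_indicator)
      show ?thesis unfolding zero using False by simp
    qed
  qed
  finally show ?case .
qed

text \<open>With lower limit 0 the last argument contributes \<open>dpow s (i + r)\<close>. The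
  binomial coefficient turns it into \<open>dpow s r * dpow s i\<close>; the first factor is
  independent of the composition, and the second is absorbed as an offset from 0.\<close>

lemma sum_binomial_T_series:
  "(\<Sum>as\<in>weak_compositions (p + 2) m.
      ennreal (real ((last as + r) choose r)) * T_series (map Suc (butlast as) @ [Suc (last as + r)]) 0)
   = (\<integral>\<^sup>+s. ennreal (dpow s r) * tail_integral p m 0 s \<partial>csch_measure)"
proof -
  have "(\<Sum>as\<in>weak_compositions (p + 2) m.
      ennreal (real ((last as + r) choose r)) * T_series (map Suc (butlast as) @ [Suc (last as + r)]) 0)
    = (\<Sum>i\<le>m. \<Sum>as\<in>weak_compositions (Suc p) (m - i). ennreal (real ((i + r) choose r)) *
        (\<integral>\<^sup>+s. ennreal (dpow s (i + r)) * T_series (map Suc as) s * indicator {0..} s \<partial>csch_measure))"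
    by (simp add: sum_weak_compositions_Suc[of _ "Suc p"] T_series_snoc)
  also have "\<dots> = (\<integral>\<^sup>+s. (\<Sum>i\<le>m. \<Sum>as\<in>weak_compositions (Suc p) (m - i). ennreal (real ((i + r) choose r)) *
        (ennreal (dpow s (i + r)) * T_series (map Suc as) s * indicator {0..} s)) \<partial>csch_measure)"
    by (simp add: nn_integral_sum nn_integral_cmult)
  also have "\<dots> = (\<integral>\<^sup>+s. ennreal (dpow s r) * tail_integral p m 0 s \<partial>csch_measure)"
  proof (intro nn_integral_cong_AE eventually_mono[OF AE_csch_measure_pos])
    fix s :: real assume s: "0 < s"
    have *: "ennreal (real ((i + r) choose r)) * ennreal (dpow s (i + r)) = ennreal (dpow s r) * ennreal (dpow s i)" for i
      using s dpow_mult[of s i r] by (simp add: ennreal_mult'[symmetric] dpow_nonneg mult_ac)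
    have "(\<Sum>i\<le>m. \<Sum>as\<in>weak_compositions (Suc p) (m - i). ennreal (real ((i + r) choose r)) *
        (ennreal (dpow s (i + r)) * T_series (map Suc as) s * indicator {0..} s))
      = (\<Sum>i\<le>m. ennreal (real ((i + r) choose r)) * ennreal (dpow s (i + r)) * tail_integral p (m - i) s s)"
      using s by (simp add: sum_distrib_left[symmetric] sum_T_series_weak_compositions[OF s] mult.assoc)
    also have "\<dots> = ennreal (dpow s r) * tail_integral p m 0 s"
      using s sum_dpow_tail_integral[where u=0 and s=s and n=m and p=p] unfolding *
      by (simp add: sum_distrib_left[symmetric] mult.assoc)
    finally show "(\<Sum>i\<le>m. \<Sum>as\<in>weak_compositions (Suc p) (m - i). ennreal (real ((i + r) choose r)) *
        (ennreal (dpow s (i + r)) * T_series (map Suc as) s * indicator {0..} s))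
      = ennreal (dpow s r) * tail_integral p m 0 s" .
  qed
  finally show ?thesis .
qed

subsection \<open>Height one values and duality\<close>

text \<open>For positive \<open>m\<close> this is T(1,...,1,m+1) with \<open>j\<close> ones, see
  \<open>T_series_replicate_1_snoc\<close>. Height one refers to the single argument above
  1.\<close>

definition height_one :: "nat \<Rightarrow> nat \<Rightarrow> ennreal" where
  "height_one j m = (\<integral>\<^sup>+s. ennreal (dpow (lcoth s) j * dpow s m) \<partial>csch_measure)"

text \<open>An argument 1 has trivial kernel, so this is the \<mu>-volume of \<open>j\<close>
  ordered points above \<open>u\<close>.\<close>

lemma T_series_replicate_1:
  "0 < u \<Longrightarrow> T_series (replicate j 1) u = ennreal (dpow (lcoth u) j)"
proof (induction j arbitrary: u)
  case (Suc j)
  have "T_series (replicate (Suc j) 1) u = T_series (replicate j 1 @ [Suc 0]) u"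
    by (simp add: replicate_append_same)
  also have "\<dots> = (\<integral>\<^sup>+s. ennreal (dpow (lcoth s) j) * indicator {u..} s \<partial>csch_measure)"
    using Suc by (subst T_series_snoc) (auto intro!: nn_integral_cong split: split_indicator)
  finally show ?case using nn_integral_csch_dpow_lcoth_tail[OF Suc.prems] by simp
qed simp

lemma T_series_replicate_1_snoc: "T_series (replicate j 1 @ [Suc m]) 0 = height_one j m"
  unfolding height_one_def T_series_snoc[OF order_refl]
  by (intro nn_integral_cong_AE eventually_mono[OF AE_csch_measure_pos])
     (use T_series_replicate_1 in \<open>auto simp: dpow_nonneg ennreal_mult' mult.commute\<close>)

text \<open>Integration by parts in the form of Tonelli's theorem: \<open>dpow s (Suc r)\<close> is
  written as an integral over x in [0, s], and the \<open>s\<close>-integral over the tail from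
  \<open>x\<close> is then evaluated first.\<close>

lemma height_one_eq_lborel:
  "height_one p (Suc r) = (\<integral>\<^sup>+x. ennreal (dpow x r * dpow (lcoth x) (Suc p)) * indicator {0<..} x \<partial>lborel)"
proof -
  have "height_one p (Suc r) = (\<integral>\<^sup>+s. (\<integral>\<^sup>+x. ennreal (dpow (lcoth s) p) * (ennreal (dpow x r) * indicator {0..s} x) \<partial>lborel) \<partial>csch_measure)"
    unfolding height_one_def
  proof (intro nn_integral_cong_AE eventually_mono[OF AE_csch_measure_pos])
    fix s :: real assume "0 < s"
    then show "ennreal (dpow (lcoth s) p * dpow s (Suc r)) = (\<integral>\<^sup>+x. ennreal (dpow (lcoth s) p) * (ennreal (dpow x r) * indicator {0..s} x) \<partial>lborel)"
      by (subst nn_integral_cmult) (auto simp: nn_integral_dpow_Icc ennreal_mult'' dpow_nonneg)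
  qed
  also have "\<dots> = (\<integral>\<^sup>+s. (\<integral>\<^sup>+x. ennreal (dpow (lcoth s) p) * (ennreal (dpow x r) * (indicator {0..} x * indicator {x..} s)) \<partial>lborel) \<partial>csch_measure)"
    by (intro nn_integral_cong) (auto split: split_indicator)
  also have "\<dots> = (\<integral>\<^sup>+x. (\<integral>\<^sup>+s. ennreal (dpow (lcoth s) p) * (ennreal (dpow x r) * (indicator {0..} x * indicator {x..} s)) \<partial>csch_measure) \<partial>lborel)"
  proof (rule csch_lborel.Fubini'[symmetric])
    have [measurable]: "(\<lambda>(s, x). indicator {x..} s :: ennreal) \<in> borel_measurable (borel \<Otimes>\<^sub>M (borel :: real measure))"
      using measurable_pair_swap[OF indicator_tail_measurable] by simp
    show "(\<lambda>(s, x). ennreal (dpow (lcoth s) p) * (ennreal (dpow x r) * (indicator {0..} x * indicator {x..} s)))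
        \<in> borel_measurable (csch_measure \<Otimes>\<^sub>M lborel)"
      by measurable
  qed
  also have "\<dots> = (\<integral>\<^sup>+x. ennreal (dpow x r * dpow (lcoth x) (Suc p)) * indicator {0<..} x \<partial>lborel)"
  proof (intro nn_integral_cong_AE eventually_mono[OF AE_lborel_singleton[of 0]])
    fix x :: real assume "x \<noteq> 0"
    show "(\<integral>\<^sup>+s. ennreal (dpow (lcoth s) p) * (ennreal (dpow x r) * (indicator {0..} x * indicator {x..} s)) \<partial>csch_measure)
      = ennreal (dpow x r * dpow (lcoth x) (Suc p)) * indicator {0<..} x"
    proof (cases "0 < x")
      case True
      have "(\<integral>\<^sup>+s. ennreal (dpow (lcoth s) p) * (ennreal (dpow x r) * (indicator {0..} x * indicator {x..} s)) \<partial>csch_measure)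
        = (\<integral>\<^sup>+s. ennreal (dpow x r) * (ennreal (dpow (lcoth s) p) * indicator {x..} s) \<partial>csch_measure)"
        using True by (simp add: mult_ac)
      also have "\<dots> = ennreal (dpow x r) * ennreal (dpow (lcoth x) (Suc p))"
        unfolding nn_integral_csch_dpow_lcoth_tail[OF True, symmetric]
        by (rule nn_integral_cmult) measurable
      finally show ?thesis using True by (simp add: ennreal_mult' dpow_nonneg)
    qed (use \<open>x \<noteq> 0\<close> in auto)
  qed
  finally show ?thesis .
qed

text \<open>Substituting x = N(v) in the Lebesgue integral restores \<mu> and exchanges the roles of
  x and N(x).\<close>

lemma height_one_duality: "height_one p (Suc r) = height_one r (Suc p)"
proof -
  have "height_one p (Suc r) = (\<integral>\<^sup>+v. ennreal (dpow (lcoth v) r * dpow (lcoth (lcoth v)) (Suc p)) \<partial>csch_measure)"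
    unfolding height_one_eq_lborel
    by (rule nn_integral_lcoth_substitution[symmetric]) measurable
  also have "\<dots> = height_one r (Suc p)"
    unfolding height_one_def
    by (intro nn_integral_cong_AE eventually_mono[OF AE_csch_measure_pos]) (simp add: lcoth_lcoth)
  finally show ?thesis .
qed

lemma T_series_snoc_antimono:
  assumes "l \<le> k"
  shows "T_series (ks @ [k]) u \<le> T_series (ks @ [l]) u"
proof -
  \<comment> \<open>Writing the last index as \<open>n + 1\<close> makes it at least 1, so that its
    powers grow with the exponent; the enumerated indices all have this form.\<close>
  have "T_term (ks @ [k]) u (ms @ [n + 1]) \<le> T_term (ks @ [l]) u (ms @ [n + 1])"
    if "length ms = length ks" for ms n
    unfolding T_term_snoc[OF that]
    by (intro mult_left_mono mult_right_mono divide_left_mono power_increasing assms T_term_nonneg) auto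
  then show ?thesis
    unfolding T_series_def length_append_singleton nn_integral_T_indices_Suc
    by (intro nn_integral_mono ennreal_leI) (auto simp: T_indices_def)
qed

text \<open>Lowering the last argument to 2 only increases the value. Duality turns T(1,...,1,2)
  into a value of depth one, which is at most T(2), a convergent series.\<close>

lemma height_one_finite:
  assumes "0 < m"
  shows "height_one j m < \<infinity>"
proof -
  obtain m' where m: "m = Suc m'" using assms by (cases m) auto
  have "height_one j m \<le> height_one j (Suc 0)"
    unfolding T_series_replicate_1_snoc[symmetric] m by (intro T_series_snoc_antimono) simp
  also have "\<dots> = height_one 0 (Suc j)" by (rule height_one_duality)
  also have "\<dots> \<le> height_one 0 (Suc 0)"
    unfolding T_series_replicate_1_snoc[symmetric] by (intro T_series_snoc_antimono) simp
  also have "\<dots> = T_series ([] @ [2]) 0"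
    by (simp add: T_series_replicate_1_snoc[symmetric] numeral_2_eq_2)
  also have "\<dots> = (\<Sum>i. ennreal (2 / real (2 * i + 1) ^ 2))"
    unfolding T_series_def
    by (simp add: nn_integral_T_indices_Suc nn_integral_count_space_finite nn_integral_count_space_nat T_term_def)
  also have "\<dots> < \<infinity>"
  proof -
    have "summable (\<lambda>i. 2 * (1 / real (Suc i) ^ 2))"
      using inverse_power_summable[of 2] summable_Suc_iff[of "\<lambda>n. 1 / real n ^ 2"]
      by (intro summable_mult) (simp add: field_simps)
    then have "summable (\<lambda>i. 2 / real (2 * i + 1) ^ 2)"
      by (rule summable_comparison_test') (auto intro!: divide_left_mono power_mono)
    then show ?thesis
      by (simp add: suminf_ennreal_eq[OF _ summable_sums])
  qed
  finally show ?thesis .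
qed

subsection \<open>The integral over the square\<close>

text \<open>Real-valued, since for odd \<open>p\<close> the first factor changes sign across the
  diagonal of the positive quadrant. Bochner integrals are therefore used from here on.\<close>

definition square_kernel :: "nat \<Rightarrow> nat \<Rightarrow> nat \<Rightarrow> real \<times> real \<Rightarrow> real" where
  "square_kernel p m r = (\<lambda>(s, q). dpow (lcoth s - lcoth q) p * (dpow q m * dpow s r))"

lemma square_kernel_measurable [measurable]:
  "square_kernel p m r \<in> borel_measurable (csch_measure \<Otimes>\<^sub>M csch_measure)"
  unfolding square_kernel_def by measurable

lemma square_kernel_expand:
  "square_kernel p m r (s, q) =
     (\<Sum>j\<le>p. (-1) ^ j * ((dpow (lcoth s) (p - j) * dpow s r) * (dpow (lcoth q) j * dpow q m)))"
proof -
  have "dpow (lcoth s - lcoth q) p = (\<Sum>j\<le>p. (-1) ^ j * dpow (lcoth q) j * dpow (lcoth s) (p - j))"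
    using dpow_add[of "- lcoth q" "lcoth s" p] by (simp add: dpow_minus)
  then show ?thesis
    by (simp add: square_kernel_def sum_distrib_left mult_ac)
qed

text \<open>Reflection in the diagonal negates the \<open>lcoth\<close> difference; this is the
  origin of the sign (-1)^k in the theorem.\<close>

lemma square_kernel_swap:
  "square_kernel p m r (s, q) = (-1) ^ p * square_kernel p r m (q, s)"
  using dpow_minus[of "lcoth q - lcoth s" p] by (simp add: square_kernel_def mult_ac)

lemma
  assumes "0 < m"
  shows integrable_height_one: "integrable csch_measure (\<lambda>s. dpow (lcoth s) j * dpow s m)" (is ?int)
    and integral_height_one: "(\<integral>s. dpow (lcoth s) j * dpow s m \<partial>csch_measure) = enn2real (height_one j m)" (is ?eq)
proof -
  have nn: "AE s in csch_measure. 0 \<le> dpow (lcoth s) j * dpow s m"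
    by (rule eventually_mono[OF AE_csch_measure_pos]) (simp add: dpow_nonneg lcoth_pos less_imp_le)
  show ?int
  proof (rule integrableI_nonneg[OF _ nn])
    show "(\<integral>\<^sup>+s. ennreal (dpow (lcoth s) j * dpow s m) \<partial>csch_measure) < \<infinity>"
      using height_one_finite[OF assms] unfolding height_one_def .
  qed measurable
  show ?eq
    unfolding height_one_def by (rule integral_eq_nn_integral[OF _ nn]) measurable
qed

lemma (in pair_sigma_finite)
  fixes f g :: "_ \<Rightarrow> real"
  assumes f: "integrable M1 f" and g: "integrable M2 g"
  shows integrable_pair_mult: "integrable (M1 \<Otimes>\<^sub>M M2) (\<lambda>(x, y). f x * g y)" (is ?int)
    and integral_pair_mult: "(\<integral>(x, y). f x * g y \<partial>(M1 \<Otimes>\<^sub>M M2)) = (\<integral>x. f x \<partial>M1) * (\<integral>y. g y \<partial>M2)" (is ?eq)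
proof -
  note [measurable] = borel_measurable_integrable[OF f] borel_measurable_integrable[OF g]
  show int: ?int
    using f g by (intro Fubini_integrable) (auto simp: abs_mult)
  show ?eq
    using integral_fst'[OF int] by simp
qed

text \<open>The binomial expansion is a finite signed sum of products in separated variables, each
  factor being integrable by finiteness of the height one values.\<close>

lemma integrable_square_kernel:
  assumes "0 < m" "0 < r"
  shows "integrable (csch_measure \<Otimes>\<^sub>M csch_measure) (square_kernel p m r)"
proof -
  have "integrable (csch_measure \<Otimes>\<^sub>M csch_measure)
     (\<lambda>x. \<Sum>j\<le>p. (-1) ^ j * (case x of (s, q) \<Rightarrow> (dpow (lcoth s) (p - j) * dpow s r) * (dpow (lcoth q) j * dpow q m)))"
    using assms by (intro Bochner_Integration.integrable_sum integrable_mult_right csch2.integrable_pair_mult integrable_height_one)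
  also have "(\<lambda>x. \<Sum>j\<le>p. (-1) ^ j * (case x of (s, q) \<Rightarrow> (dpow (lcoth s) (p - j) * dpow s r) * (dpow (lcoth q) j * dpow q m)))
     = square_kernel p m r"
    by (auto simp: fun_eq_iff square_kernel_expand)
  finally show ?thesis .
qed

lemma integral_square_kernel:
  assumes "0 < m" "0 < r"
  shows "(\<integral>x. square_kernel p m r x \<partial>(csch_measure \<Otimes>\<^sub>M csch_measure))
    = (\<Sum>j\<le>p. (-1) ^ j * enn2real (height_one (p - j) r) * enn2real (height_one j m))"
proof -
  let ?M = "csch_measure \<Otimes>\<^sub>M csch_measure"
  let ?f = "\<lambda>j (s, q). (dpow (lcoth s) (p - j) * dpow s r) * (dpow (lcoth q) j * dpow q m)"
  have "(\<integral>x. square_kernel p m r x \<partial>?M) = (\<integral>x. (\<Sum>j\<le>p. (-1) ^ j * ?f j x) \<partial>?M)"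
    by (intro Bochner_Integration.integral_cong refl) (auto simp: square_kernel_expand)
  also have "\<dots> = (\<Sum>j\<le>p. \<integral>x. (-1) ^ j * ?f j x \<partial>?M)"
    using assms by (intro Bochner_Integration.integral_sum integrable_mult_right csch2.integrable_pair_mult integrable_height_one)
  also have "\<dots> = (\<Sum>j\<le>p. (-1) ^ j * enn2real (height_one (p - j) r) * enn2real (height_one j m))"
  proof (intro sum.cong refl)
    fix j
    have "(\<integral>x. ?f j x \<partial>?M) = enn2real (height_one (p - j) r) * enn2real (height_one j m)"
      using assms by (simp only: csch2.integral_pair_mult integrable_height_one integral_height_one)
    then show "(\<integral>x. (-1) ^ j * ?f j x \<partial>?M) = (-1) ^ j * enn2real (height_one (p - j) r) * enn2real (height_one j m)"
      by (simp only: integral_mult_right_zero mult.assoc)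
  qed
  finally show ?thesis .
qed

text \<open>This is the first composition sum for k = p + 2, by
  \<open>sum_binomial_T_series\<close>, and also the integral of the kernel over the half s \<le> q,
  by \<open>integral_ordered_part\<close>.\<close>

definition ordered_part :: "nat \<Rightarrow> nat \<Rightarrow> nat \<Rightarrow> ennreal" where
  "ordered_part p m r = (\<integral>\<^sup>+s. ennreal (dpow s r) * tail_integral p m 0 s \<partial>csch_measure)"

lemma pred_le_measurable [measurable]:
  "{x. fst x \<le> snd x} \<in> sets (csch_measure \<Otimes>\<^sub>M csch_measure)"
  "{x. snd x \<le> fst x} \<in> sets (csch_measure \<Otimes>\<^sub>M csch_measure)"
proof -
  have "{x \<in> space (csch_measure \<Otimes>\<^sub>M csch_measure). fst x \<le> snd x} \<in> sets (csch_measure \<Otimes>\<^sub>M csch_measure)"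
    "{x \<in> space (csch_measure \<Otimes>\<^sub>M csch_measure). snd x \<le> fst x} \<in> sets (csch_measure \<Otimes>\<^sub>M csch_measure)"
    by measurable
  then show "{x. fst x \<le> snd x} \<in> sets (csch_measure \<Otimes>\<^sub>M csch_measure)"
    "{x. snd x \<le> fst x} \<in> sets (csch_measure \<Otimes>\<^sub>M csch_measure)"
    by (simp_all add: space_pair_measure)
qed

text \<open>\<mu> has no atoms, so the diagonal is a null set and the two closed halves of the
  square may overlap there.\<close>

lemma AE_csch_pair: "AE x in csch_measure \<Otimes>\<^sub>M csch_measure. 0 < fst x \<and> fst x \<noteq> snd x"
proof (rule csch2.AE_pair_measure)
  have "{x \<in> space (csch_measure \<Otimes>\<^sub>M csch_measure). 0 < fst x \<and> fst x \<noteq> snd x} \<in> sets (csch_measure \<Otimes>\<^sub>M csch_measure)"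
    by measurable
  then show "{x \<in> space (csch_measure \<Otimes>\<^sub>M csch_measure). 0 < fst x \<and> fst x \<noteq> snd x} \<in> sets (csch_measure \<Otimes>\<^sub>M csch_measure)" .
  have "AE q in csch_measure. 0 < fst (s, q) \<and> fst (s, q) \<noteq> snd (s, q)" if "0 < s" for s
    by (rule eventually_mono[OF AE_csch_measure_neq[of s]]) (use that in auto)
  then show "AE s in csch_measure. AE q in csch_measure. 0 < fst (s, q) \<and> fst (s, q) \<noteq> snd (s, q)"
    by (rule eventually_mono[OF AE_csch_measure_pos])
qed

lemma integrable_square_kernel_indicator:
  assumes "0 < m" "0 < r" "A \<in> sets (csch_measure \<Otimes>\<^sub>M csch_measure)"
  shows "integrable (csch_measure \<Otimes>\<^sub>M csch_measure) (\<lambda>x. indicator A x * square_kernel p m r x)"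
  using integrable_mult_indicator[OF assms(3) integrable_square_kernel[OF assms(1,2)]] by simp

text \<open>On s \<le> q the kernel is nonnegative because N decreases, so both notions of integral
  agree. Finiteness comes from integrability over the whole square.\<close>

lemma
  assumes "0 < m" "0 < r"
  shows ordered_part_finite: "ordered_part p m r < \<infinity>" (is ?fin)
    and integral_ordered_part: "(\<integral>x. indicator {x. fst x \<le> snd x} x * square_kernel p m r x
       \<partial>(csch_measure \<Otimes>\<^sub>M csch_measure)) = enn2real (ordered_part p m r)" (is ?eq)
proof -
  let ?M = "csch_measure \<Otimes>\<^sub>M csch_measure"
  let ?f = "\<lambda>x. indicator {x. fst x \<le> snd x} x * square_kernel p m r x"
  have meas [measurable]: "?f \<in> borel_measurable ?M" by measurable
  have int: "integrable ?M ?f"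
    using assms by (intro integrable_square_kernel_indicator) measurable
  have nn: "AE x in ?M. 0 \<le> ?f x"
  proof (rule eventually_mono[OF AE_csch_pair])
    fix x :: "real \<times> real" assume x: "0 < fst x \<and> fst x \<noteq> snd x"
    obtain s q where xe: "x = (s, q)" by (cases x)
    show "0 \<le> ?f x"
    proof (cases "s \<le> q")
      case True
      then show ?thesis
        using x lcoth_antimono[of s q] unfolding xe square_kernel_def
        by (auto intro!: mult_nonneg_nonneg dpow_nonneg)
    qed (simp add: xe)
  qed
  have "(\<integral>\<^sup>+x. ennreal (?f x) \<partial>?M) = (\<integral>\<^sup>+s. (\<integral>\<^sup>+q. ennreal (?f (s, q)) \<partial>csch_measure) \<partial>csch_measure)"
    by (rule csch.nn_integral_fst[symmetric]) measurable
  also have "\<dots> = ordered_part p m r"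
    unfolding ordered_part_def
  proof (intro nn_integral_cong_AE eventually_mono[OF AE_csch_measure_pos])
    fix s :: real assume s: "0 < s"
    have "(\<integral>\<^sup>+q. ennreal (?f (s, q)) \<partial>csch_measure)
      = (\<integral>\<^sup>+q. ennreal (dpow s r) * (ennreal (dpow (lcoth s - lcoth q) p * dpow (q - 0) m) * indicator {s..} q) \<partial>csch_measure)"
      using s by (intro nn_integral_cong)
        (auto simp: square_kernel_def dpow_nonneg ennreal_mult'[symmetric] mult_ac split: split_indicator)
    also have "\<dots> = ennreal (dpow s r) * tail_integral p m 0 s"
      unfolding tail_integral_def by (rule nn_integral_cmult) measurable
    finally show "(\<integral>\<^sup>+q. ennreal (?f (s, q)) \<partial>csch_measure) = ennreal (dpow s r) * tail_integral p m 0 s" .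
  qed
  finally have eq: "(\<integral>\<^sup>+x. ennreal (?f x) \<partial>?M) = ordered_part p m r" .
  show ?eq
    unfolding eq[symmetric] by (rule integral_eq_nn_integral[OF meas nn])
  have "(\<integral>\<^sup>+x. ennreal (?f x) \<partial>?M) = ennreal (\<integral>x. ?f x \<partial>?M)"
    by (rule nn_integral_eq_integral[OF int nn])
  then show ?fin unfolding eq by simp
qed

lemma ordered_part_add:
  assumes "0 < m" "0 < r"
  shows "enn2real (ordered_part p m r) + (-1) ^ p * enn2real (ordered_part p r m)
    = (\<Sum>j\<le>p. (-1) ^ j * enn2real (height_one (p - j) r) * enn2real (height_one j m))"
proof -
  let ?M = "csch_measure \<Otimes>\<^sub>M csch_measure"
  let ?A = "{x :: real \<times> real. fst x \<le> snd x}" and ?B = "{x :: real \<times> real. snd x \<le> fst x}"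
  let ?f = "square_kernel p m r"
  have "(\<integral>x. ?f x \<partial>?M) = (\<integral>x. indicator ?A x * ?f x + indicator ?B x * ?f x \<partial>?M)"
    by (rule integral_cong_AE)
       (measurable, rule eventually_mono[OF AE_csch_pair], auto split: split_indicator)
  also have "\<dots> = (\<integral>x. indicator ?A x * ?f x \<partial>?M) + (\<integral>x. indicator ?B x * ?f x \<partial>?M)"
    using assms by (intro Bochner_Integration.integral_add integrable_square_kernel_indicator) measurable
  \<comment> \<open>Exchanging the coordinates moves the lower half onto the upper one, at the cost
    of the sign and of swapping \<open>m\<close> and \<open>r\<close>.\<close>
  also have "(\<integral>x. indicator ?B x * ?f x \<partial>?M) = (\<integral>(s, q). indicator ?B (q, s) * ?f (q, s) \<partial>?M)"
    by (rule csch2.integral_product_swap[symmetric]) measurable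
  also have "\<dots> = (\<integral>x. (-1) ^ p * (indicator ?A x * square_kernel p r m x) \<partial>?M)"
  proof (intro Bochner_Integration.integral_cong refl)
    fix x :: "real \<times> real"
    show "(case x of (s, q) \<Rightarrow> indicator ?B (q, s) * ?f (q, s)) = (-1) ^ p * (indicator ?A x * square_kernel p r m x)"
      by (cases x) (auto simp: square_kernel_swap[of p m r] split: split_indicator)
  qed
  finally show ?thesis
    using assms by (simp add: integral_square_kernel integral_ordered_part)
qed

section \<open>Return to real values and the final identity\<close>

lemma sum_binomial_T:
  assumes "0 < m" "0 < r"
  shows "(\<Sum>as\<in>weak_compositions (p + 2) m. real ((last as + r) choose r) *
      T (map (\<lambda>a. a + 1) (butlast as) @ [last as + r + 1])) = enn2real (ordered_part p m r)"
proof -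
  let ?t = "\<lambda>as. ennreal (real ((last as + r) choose r)) * T_series (map Suc (butlast as) @ [Suc (last as + r)]) 0"
  have sum: "(\<Sum>as\<in>weak_compositions (p + 2) m. ?t as) = ordered_part p m r"
    unfolding ordered_part_def by (rule sum_binomial_T_series)
  \<comment> \<open>\<open>enn2real\<close> is additive only on finite values; each summand is
    bounded by the total, which is finite.\<close>
  have "?t as < top" if "as \<in> weak_compositions (p + 2) m" for as
    using ordered_part_finite[OF assms, of p] that unfolding sum[symmetric] infinity_ennreal_def
    by (intro le_less_trans[OF member_le_sum[of as _ ?t]]) auto
  then have "enn2real (\<Sum>as\<in>weak_compositions (p + 2) m. ?t as) = (\<Sum>as\<in>weak_compositions (p + 2) m. enn2real (?t as))"
    using enn2real_sum[of "weak_compositions (p + 2) m" ?t] by (simp add: o_def)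
  then show ?thesis
    unfolding sum by (simp add: enn2real_mult T_eq_enn2real_T_series)
qed

theorem theorem5p9:
  fixes m r k :: nat
  assumes "m \<ge> 1" and "r \<ge> 1" and "k \<ge> 2"
  shows
    "(\<Sum>as\<in>weak_compositions k m.
        real ((last as + r) choose r) * T (map (\<lambda>a. a + 1) (butlast as) @ [last as + r + 1]))
     + (-1) ^ k * (\<Sum>as\<in>weak_compositions k r.
        real ((last as + m) choose m) * T (map (\<lambda>a. a + 1) (butlast as) @ [last as + m + 1]))
     = (\<Sum>j=0..k-2. (-1) ^ j * T (replicate (r - 1) 1 @ [k - j]) * T (replicate j 1 @ [m + 1]))"
proof -
  obtain p where k: "k = p + 2" using assms(3) by (metis add.commute le_Suc_ex)
  have pos: "0 < m" "0 < r" using assms by auto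
  \<comment> \<open>The T-value is \<open>height_one (r - 1) (Suc (p - j))\<close>, while the square
    produces its dual \<open>height_one (p - j) r\<close>.\<close>
  have "T (replicate (r - 1) 1 @ [k - j]) = enn2real (height_one (p - j) r)" if "j \<le> p" for j
  proof -
    have "replicate (r - 1) 1 @ [k - j] = replicate (r - 1) 1 @ [Suc (Suc (p - j))]"
      using that by (simp add: k)
    then show ?thesis
      using height_one_duality[of "p - j" "r - 1"] pos
      by (simp only: T_eq_enn2real_T_series T_series_replicate_1_snoc) simp
  qed
  moreover have "T (replicate j 1 @ [m + 1]) = enn2real (height_one j m)" for j
    by (simp only: T_eq_enn2real_T_series Suc_eq_plus1[symmetric] T_series_replicate_1_snoc)
  ultimately have "(\<Sum>j=0..k-2. (-1) ^ j * T (replicate (r - 1) 1 @ [k - j]) * T (replicate j 1 @ [m + 1]))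
    = (\<Sum>j\<le>p. (-1) ^ j * enn2real (height_one (p - j) r) * enn2real (height_one j m))"
    by (intro sum.cong) (auto simp: k)
  then show ?thesis
    \<comment> \<open>The signs agree because k = p + 2 has the parity of p.\<close>
    unfolding k sum_binomial_T[OF pos] sum_binomial_T[OF pos(2,1)]
    using ordered_part_add[OF pos, of p] by simp
qed

end
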